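(* Let $G$ be a disconnected split graph (finite, simple, undirected). Case 1: If $G$ has no connected component with at least two vertices, so that $G$ consists of $n$ isolated vertices, then $b(G) = n$. Case 2: If $G$ consists of one connected component $G_c$ with at least two vertices together with a set of $n$ isolated vertices ($n \ge 1$), then $b(G) \leq 3$ if $n \leq 2$, and $b(G) = n+1$ otherwise.
   Context: A split graph is a graph whose vertex set can be partitioned into a clique (a set of mutually adjacent vertices) and an independent set (a set of mutually non-adjacent vertices). A disconnected split graph is either a set of isolated vertices, or one connected split component with at least two vertices together with a set of isolated vertices. Graph burning: initially all vertices of a finite simple undirected graph $G$ are unburned. The process runs in rounds $t = 1, 2, 3, \dots$. In round $t$, a vertex $x_t$ that is not burned at the end of round $t-1$ is chosen as a new source of fire and becomes burned; simultaneously, every vertex adjacent to a vertex that was burned at the end of round $t-1$ becomes burned. Burned vertices remain burned. The process ends at the first round after which all vertices of $G$ are burned. The burning number $b(G)$ is the minimum, over all choices of sources, of the number of rounds needed to burn all vertices of $G$. *)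

theory Defs
  imports "Graph_Theory.Digraph_Component"
begin

(* A finite simple undirected graph is an instance of the locale graph: finite, symmetric, without
   loops or parallel arcs; adjacency is u \<rightarrow>\<^bsub>G\<^esub> v. *)

(* By symmetry the strongly connected components are the connected components. *)
abbreviation components :: "('a, 'b) pre_digraph \<Rightarrow> ('a, 'b) pre_digraph set" where
  "components G \<equiv> pre_digraph.sccs G"

(* The predicate connected of Graph_Theory is false for the null graph, which is not meant to count
   as disconnected. *)
definition disconnected :: "('a, 'b) pre_digraph \<Rightarrow> bool" where
  "disconnected G \<longleftrightarrow> verts G \<noteq> {} \<and> \<not> connected G"

definition isolated_verts :: "('a, 'b) pre_digraph \<Rightarrow> 'a set" where
  "isolated_verts G = {v \<in> verts G. \<forall>u \<in> verts G. \<not> v \<rightarrow>\<^bsub>G\<^esub> u}"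

definition clique :: "('a, 'b) pre_digraph \<Rightarrow> 'a set \<Rightarrow> bool" where
  "clique G K \<longleftrightarrow> K \<subseteq> verts G \<and> (\<forall>u \<in> K. \<forall>v \<in> K. u \<noteq> v \<longrightarrow> u \<rightarrow>\<^bsub>G\<^esub> v)"

definition independent_set :: "('a, 'b) pre_digraph \<Rightarrow> 'a set \<Rightarrow> bool" where
  "independent_set G I \<longleftrightarrow> I \<subseteq> verts G \<and> (\<forall>u \<in> I. \<forall>v \<in> I. \<not> u \<rightarrow>\<^bsub>G\<^esub> v)"

(* Either part may be empty. *)
definition split_graph :: "('a, 'b) pre_digraph \<Rightarrow> bool" where
  "split_graph G \<longleftrightarrow>
     (\<exists>K I. K \<union> I = verts G \<and> K \<inter> I = {} \<and> clique G K \<and> independent_set G I)"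

(* The vertices burned at the end of round t, where x t is the source chosen in round t. Rounds are
   numbered from 1, so x 0 is irrelevant. *)
primrec burned :: "('a, 'b) pre_digraph \<Rightarrow> (nat \<Rightarrow> 'a) \<Rightarrow> nat \<Rightarrow> 'a set" where
  "burned G x 0 = {}"
| "burned G x (Suc t) =
     burned G x t \<union> {v \<in> verts G. \<exists>u \<in> burned G x t. u \<rightarrow>\<^bsub>G\<^esub> v} \<union> {x (Suc t)}"

(* x describes a legal run of the process that ends exactly after round k. In each round, the last
   one included, a source must be chosen among the vertices not burned before that round. *)
definition burns_in :: "('a, 'b) pre_digraph \<Rightarrow> (nat \<Rightarrow> 'a) \<Rightarrow> nat \<Rightarrow> bool" where
  "burns_in G x k \<longleftrightarrow>
     (\<forall>t \<in> {1..k}. x t \<in> verts G - burned G x (t - 1)) \<and>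
     burned G x k = verts G \<and> (\<forall>t < k. burned G x t \<noteq> verts G)"

definition burning_number :: "('a, 'b) pre_digraph \<Rightarrow> nat" where
  "burning_number G = (LEAST k. \<exists>x. burns_in G x k)"

end

(* In a split graph every non-isolated vertex is within distance 2 of any non-isolated vertex v of
   the clique, so a fire started at v in round 1 has burned all of them after round 3. An isolated
   vertex burns only by being a source, so the process with sources v, i_1, ..., i_n, where the i_j
   are the isolated vertices, is legal, and for n \<ge> 2 it ends exactly after round n + 1. Conversely
   all n isolated vertices must be sources, and so must some non-isolated vertex. *)
theory Submission
  imports Defs
begin

section \<open>Runs of the burning process in an arbitrary digraph\<close>

lemma burned_cong:
  "(\<And>s. 1 \<le> s \<Longrightarrow> s \<le> t \<Longrightarrow> x s = y s) \<Longrightarrow> burned G x t = burned G y t"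
  by (induction t) auto

lemma burned_mono: "s \<le> t \<Longrightarrow> burned G x s \<subseteq> burned G x t"
  by (rule lift_Suc_mono_le[of "burned G x"]) auto

lemma source_burned: "1 \<le> t \<Longrightarrow> x t \<in> burned G x t"
  by (cases t) auto

lemma burned_subset_verts:
  "(\<And>s. s \<in> {1..t} \<Longrightarrow> x s \<in> verts G) \<Longrightarrow> burned G x t \<subseteq> verts G"
  by (induction t) auto

text \<open>Minimality of the number of rounds is automatic, because the last source is not burned
  before the last round.\<close>

lemma burns_in_iff:
  "burns_in G x k \<longleftrightarrow>
     (\<forall>t \<in> {1..k}. x t \<in> verts G - burned G x (t - 1)) \<and> burned G x k = verts G"
proof -
  have "burned G x t \<noteq> verts G"
    if legal: "\<forall>t \<in> {1..k}. x t \<in> verts G - burned G x (t - 1)" and "t < k" for t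
  proof -
    have "x k \<in> verts G - burned G x (k - 1)"
      using legal \<open>t < k\<close> by auto
    moreover have "burned G x t \<subseteq> burned G x (k - 1)"
      using \<open>t < k\<close> by (intro burned_mono) auto
    ultimately show ?thesis by auto
  qed
  then show ?thesis unfolding burns_in_def by blast
qed

lemma burning_number_le: "burns_in G x k \<Longrightarrow> burning_number G \<le> k"
  unfolding burning_number_def by (rule Least_le) blast

context graph
begin

section \<open>Isolated vertices as sources, and lower bounds\<close>

lemma adj_sym: "u \<rightarrow>\<^bsub>G\<^esub> v \<Longrightarrow> v \<rightarrow>\<^bsub>G\<^esub> u"
  using sym_arcs unfolding symmetric_def by (auto dest: symD)

lemma adj_not_isolated: "u \<rightarrow>\<^bsub>G\<^esub> v \<Longrightarrow> u \<notin> isolated_verts G \<and> v \<notin> isolated_verts G"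
  using adj_sym adj_in_verts unfolding isolated_verts_def by blast

lemma not_isolatedE:
  assumes "u \<in> verts G" "u \<notin> isolated_verts G"
  obtains w where "u \<rightarrow>\<^bsub>G\<^esub> w"
  using assms unfolding isolated_verts_def by blast

lemma isolated_subset_verts: "isolated_verts G \<subseteq> verts G"
  unfolding isolated_verts_def by blast

text \<open>Fire spreads along arcs only, so the source term of \<open>burned\<close> alone can add
  such a vertex. This serves both the lower bounds and the legality of isolated sources.\<close>

lemma isolated_in_burned_iff:
  assumes "i \<in> isolated_verts G"
  shows "i \<in> burned G x t \<longleftrightarrow> i \<in> x ` {1..t}"
  by (induction t) (use assms adj_not_isolated in \<open>auto simp: atLeastAtMostSuc_conv\<close>)

text \<open>Fire cannot leave isolated vertices, so a run that burns anything else must have a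
  non-isolated source.\<close>

lemma burned_subset_isolated:
  assumes "x ` {1..t} \<subseteq> isolated_verts G"
  shows "burned G x t \<subseteq> isolated_verts G"
  using assms by (induction t) (use adj_not_isolated in \<open>auto simp: atLeastAtMostSuc_conv\<close>)

lemma isolated_subset_sources:
  assumes "burns_in G x k"
  shows "isolated_verts G \<subseteq> x ` {1..k}"
  using assms isolated_in_burned_iff isolated_subset_verts unfolding burns_in_iff by blast

lemma card_isolated_le:
  assumes "burns_in G x k"
  shows "card (isolated_verts G) \<le> k"
  using surj_card_le[OF _ isolated_subset_sources[OF assms]] by simp

lemma card_isolated_less:
  assumes "burns_in G x k" and "isolated_verts G \<noteq> verts G"
  shows "card (isolated_verts G) < k"
proof -
  \<comment> \<open>Equality would make every source isolated, and the non-isolated vertices would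
    never burn.\<close>
  have "isolated_verts G \<subset> x ` {1..k}"
    using isolated_subset_sources[OF assms(1)] burned_subset_isolated[of x k] assms
      isolated_subset_verts unfolding burns_in_iff by blast
  then have "card (isolated_verts G) < card (x ` {1..k})"
    by (intro psubset_card_mono) auto
  also have "\<dots> \<le> k"
    using card_image_le[of "{1..k}" x] by simp
  finally show ?thesis .
qed

text \<open>Any enumeration of the vertices is a legal run, since only earlier sources are burned;
  \<open>card_isolated_le\<close> gives the lower bound.\<close>

lemma burning_number_all_isolated:
  assumes "isolated_verts G = verts G"
  shows "burning_number G = card (verts G)"
  unfolding burning_number_def
proof (rule Least_equality)
  obtain x where x: "bij_betw x {1..card (verts G)} (verts G)"
    using ex_bij_betw_nat_finite_1[OF finite_verts] by blast
  have legal: "x t \<in> verts G - burned G x (t - 1)" if "t \<in> {1..card (verts G)}" for t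
  proof -
    have "x t \<in> verts G"
      using x that by (auto dest: bij_betwE)
    moreover have "x t \<notin> x ` {1..t - 1}"
      using inj_onD[OF bij_betw_imp_inj_on[OF x]] that by fastforce
    ultimately show ?thesis
      using isolated_in_burned_iff assms by blast
  qed
  moreover have "burned G x (card (verts G)) = verts G"
  proof
    show "burned G x (card (verts G)) \<subseteq> verts G"
      using legal by (intro burned_subset_verts) blast
    show "verts G \<subseteq> burned G x (card (verts G))"
      using isolated_in_burned_iff[of _ x "card (verts G)", unfolded assms]
        bij_betw_imp_surj_on[OF x] by blast
  qed
  ultimately show "\<exists>x. burns_in G x (card (verts G))"
    unfolding burns_in_iff by blast
next
  show "card (verts G) \<le> k" if "\<exists>x. burns_in G x k" for k
    using that card_isolated_le assms by auto
qed

section \<open>Reach of a clique vertex, and upper bounds\<close>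

lemma split_graph_center:
  assumes "split_graph G" and "isolated_verts G \<noteq> verts G"
  obtains v where "v \<in> verts G" "v \<notin> isolated_verts G"
    "\<And>y. y \<in> verts G \<Longrightarrow> y \<notin> isolated_verts G \<Longrightarrow> y = v \<or> v \<rightarrow>\<^bsub>G\<^esub> y \<or> (\<exists>z. v \<rightarrow>\<^bsub>G\<^esub> z \<and> z \<rightarrow>\<^bsub>G\<^esub> y)"
proof -
  obtain K I where KI: "K \<union> I = verts G" "clique G K" "independent_set G I"
    using assms(1) unfolding split_graph_def by blast
  \<comment> \<open>An arc with both ends in \<open>I\<close> would contradict independence.\<close>
  have edge: "a \<in> K \<or> b \<in> K" if "a \<rightarrow>\<^bsub>G\<^esub> b" for a b
    using that KI adj_in_verts unfolding independent_set_def by blast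
  have K_adj: "a = b \<or> a \<rightarrow>\<^bsub>G\<^esub> b" if "a \<in> K" "b \<in> K" for a b
    using that KI unfolding clique_def by blast
  obtain u w where "u \<rightarrow>\<^bsub>G\<^esub> w"
    using assms(2) isolated_subset_verts not_isolatedE by blast
  then obtain v where v: "v \<in> K" "v \<in> verts G" "v \<notin> isolated_verts G"
    using edge adj_not_isolated adj_in_verts by blast
  show ?thesis
  proof (rule that[OF v(2,3)])
    fix y assume "y \<in> verts G" "y \<notin> isolated_verts G"
    then obtain z where "y \<rightarrow>\<^bsub>G\<^esub> z"
      by (rule not_isolatedE)
    \<comment> \<open>If \<open>y\<close> is in \<open>K\<close>, it equals \<open>v\<close> or is
      adjacent to it. Otherwise \<open>z\<close> is in \<open>K\<close>, and \<open>y\<close> is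
      reached from \<open>v\<close> through \<open>z\<close>, or directly if
      \<open>z = v\<close>.\<close>
    then show "y = v \<or> v \<rightarrow>\<^bsub>G\<^esub> y \<or> (\<exists>z. v \<rightarrow>\<^bsub>G\<^esub> z \<and> z \<rightarrow>\<^bsub>G\<^esub> y)"
      using edge K_adj v(1) adj_sym by blast
  qed
qed

lemma burned_two_steps:
  assumes "x t \<rightarrow>\<^bsub>G\<^esub> z" "z \<rightarrow>\<^bsub>G\<^esub> y" "1 \<le> t"
  shows "y \<in> burned G x (t + 2)"
proof -
  have "z \<in> burned G x (Suc t)"
    using source_burned[OF assms(3)] assms(1) adj_in_verts by auto
  then show ?thesis
    using assms(2) adj_in_verts by auto
qed

text \<open>A vertex at distance d from the first source is burned by the end of round d + 1,
  whatever the later sources are; here d is at most 2.\<close>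

lemma burned_center:
  assumes "\<And>y. y \<in> verts G \<Longrightarrow> y \<notin> isolated_verts G \<Longrightarrow>
      y = x 1 \<or> x 1 \<rightarrow>\<^bsub>G\<^esub> y \<or> (\<exists>z. x 1 \<rightarrow>\<^bsub>G\<^esub> z \<and> z \<rightarrow>\<^bsub>G\<^esub> y)" and "3 \<le> k"
  shows "verts G - isolated_verts G \<subseteq> burned G x k"
proof
  fix y assume y: "y \<in> verts G - isolated_verts G"
  have sub: "burned G x 1 \<subseteq> burned G x k" "burned G x 2 \<subseteq> burned G x k"
    "burned G x 3 \<subseteq> burned G x k"
    using \<open>3 \<le> k\<close> by (intro burned_mono; linarith)+
  have "x 1 \<in> burned G x 1"
    by (rule source_burned) simp
  moreover have "y \<in> burned G x 2" if "x 1 \<rightarrow>\<^bsub>G\<^esub> y"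
    using that y by (auto simp: numeral_2_eq_2)
  moreover have "y \<in> burned G x 3" if "x 1 \<rightarrow>\<^bsub>G\<^esub> z" "z \<rightarrow>\<^bsub>G\<^esub> y" for z
    using burned_two_steps[of x 1 z y] that by (simp add: numeral_3_eq_3)
  ultimately show "y \<in> burned G x k"
    using assms(1)[of y] y sub by blast
qed

lemma burns_in_card_isolated:
  assumes "split_graph G" and "isolated_verts G \<noteq> verts G" and "card (isolated_verts G) \<ge> 2"
  shows "\<exists>x. burns_in G x (card (isolated_verts G) + 1)"
proof -
  let ?n = "card (isolated_verts G)"
  obtain v where v: "v \<in> verts G" "v \<notin> isolated_verts G"
    "\<And>y. y \<in> verts G \<Longrightarrow> y \<notin> isolated_verts G \<Longrightarrow> y = v \<or> v \<rightarrow>\<^bsub>G\<^esub> y \<or> (\<exists>z. v \<rightarrow>\<^bsub>G\<^esub> z \<and> z \<rightarrow>\<^bsub>G\<^esub> y)"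
    using split_graph_center[OF assms(1,2)] by blast
  obtain e where e: "bij_betw e {1..?n} (isolated_verts G)"
    using ex_bij_betw_nat_finite_1 finite_subset[OF isolated_subset_verts finite_verts] by blast
  \<comment> \<open>The center comes first; the shift by one places the enumeration \<open>e\<close>
    of the isolated vertices in rounds 2 to \<open>?n + 1\<close>.\<close>
  define x where "x t = (if t = 1 then v else e (t - 1))" for t
  have e_in: "e j \<in> isolated_verts G" if "j \<in> {1..?n}" for j
    using e that by (auto dest: bij_betwE)
  have legal: "x t \<in> verts G - burned G x (t - 1)" if t: "t \<in> {1..?n + 1}" for t
  proof (cases "t = 1")
    case True
    then show ?thesis using v by (simp add: x_def)
  next
    case False
    then have tn: "t - 1 \<in> {1..?n}" and xt: "x t = e (t - 1)"
      using t by (auto simp: x_def)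
    \<comment> \<open>An isolated source is legal as soon as it differs from all earlier
      sources.\<close>
    have "x t \<noteq> x s" if "s \<in> {1..t - 1}" for s
    proof (cases "s = 1")
      case True
      then show ?thesis using xt e_in[OF tn] v(2) by (auto simp: x_def)
    next
      case False
      then have "s - 1 \<in> {1..?n}" "s - 1 \<noteq> t - 1" "x s = e (s - 1)"
        using that tn by (auto simp: x_def)
      then show ?thesis
        using inj_onD[OF bij_betw_imp_inj_on[OF e]] tn xt by metis
    qed
    then have "x t \<notin> burned G x (t - 1)"
      using isolated_in_burned_iff[OF e_in[OF tn], folded xt] by blast
    then show ?thesis
      using e_in[OF tn] xt isolated_subset_verts by auto
  qed
  have "isolated_verts G \<subseteq> x ` {1..?n + 1}"
  proof
    fix i assume "i \<in> isolated_verts G"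
    then obtain j where "j \<in> {1..?n}" "i = e j"
      using bij_betw_imp_surj_on[OF e] by blast
    then show "i \<in> x ` {1..?n + 1}"
      by (intro image_eqI[of _ _ "Suc j"]) (auto simp: x_def)
  qed
  then have "isolated_verts G \<subseteq> burned G x (?n + 1)"
    using isolated_in_burned_iff by blast
  moreover have "verts G - isolated_verts G \<subseteq> burned G x (?n + 1)"
    \<comment> \<open>Two isolated vertices are needed here: they give
      \<open>3 \<le> ?n + 1\<close>.\<close>
    by (rule burned_center) (use v(3) assms(3) in \<open>auto simp: x_def\<close>)
  moreover have "burned G x (?n + 1) \<subseteq> verts G"
    using legal by (intro burned_subset_verts) blast
  ultimately have "burned G x (?n + 1) = verts G"
    by blast
  then show ?thesis
    using legal unfolding burns_in_iff by blast
qed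

text \<open>With a single isolated vertex the sources \<open>v\<close> and \<open>i\<close> may or
  may not burn everything in two rounds. If not, any unburned vertex serves as the third
  source.\<close>

lemma burning_number_le_3:
  assumes "split_graph G" and "isolated_verts G \<noteq> verts G" and "card (isolated_verts G) = 1"
  shows "burning_number G \<le> 3"
proof -
  obtain v where v: "v \<in> verts G" "v \<notin> isolated_verts G"
    "\<And>y. y \<in> verts G \<Longrightarrow> y \<notin> isolated_verts G \<Longrightarrow> y = v \<or> v \<rightarrow>\<^bsub>G\<^esub> y \<or> (\<exists>z. v \<rightarrow>\<^bsub>G\<^esub> z \<and> z \<rightarrow>\<^bsub>G\<^esub> y)"
    using split_graph_center[OF assms(1,2)] by blast
  obtain i where i: "isolated_verts G = {i}"
    using assms(3) card_1_singletonE by blast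
  \<comment> \<open>The third source \<open>w\<close> stays a parameter, since it is chosen only
    once the outcome of two rounds is known.\<close>
  define x where "x w t = (if t = 1 then v else if t = 2 then i else w)" for w and t :: nat
  have "i \<in> verts G" "i \<noteq> v"
    using i isolated_subset_verts v(2) by auto
  then have legal2: "x w t \<in> verts G - burned G (x w) (t - 1)" if "t \<in> {1..2}" for w t
  proof -
    have "t = 1 \<or> t = 2" using that by auto
    then show ?thesis
      using \<open>i \<in> verts G\<close> \<open>i \<noteq> v\<close> v(1) by (auto simp: x_def)
  qed
  \<comment> \<open>The first two sources do not depend on \<open>w\<close>; in \<open>x v\<close>
    the argument is a mere placeholder.\<close>
  have two: "burned G (x w) 2 = burned G (x v) 2" for w
    by (rule burned_cong) (auto simp: x_def)
  have "burned G (x v) 2 \<subseteq> verts G"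
    using legal2 by (intro burned_subset_verts) blast
  then consider "burned G (x v) 2 = verts G" | w where "w \<in> verts G - burned G (x v) 2"
    by blast
  then show ?thesis
  proof cases
    case 1
    then have "burns_in G (x v) 2"
      using legal2 unfolding burns_in_iff by blast
    then show ?thesis
      using burning_number_le by fastforce
  next
    case 2
    have legal: "x w t \<in> verts G - burned G (x w) (t - 1)" if "t \<in> {1..3}" for t
    proof (cases "t = 3")
      case True
      then show ?thesis using 2 two[of w] by (simp add: x_def)
    next
      case False
      then show ?thesis using that by (intro legal2) auto
    qed
    have "x w 2 = i"
      by (simp add: x_def)
    then have "i \<in> x w ` {1..3}"
      by force
    then have "isolated_verts G \<subseteq> burned G (x w) 3"
      using isolated_in_burned_iff[of i] i by simp
    moreover have "verts G - isolated_verts G \<subseteq> burned G (x w) 3"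
      by (rule burned_center) (use v(3) in \<open>auto simp: x_def\<close>)
    moreover have "burned G (x w) 3 \<subseteq> verts G"
      using legal by (intro burned_subset_verts) blast
    ultimately have "burned G (x w) 3 = verts G"
      by blast
    then have "burns_in G (x w) 3"
      using legal unfolding burns_in_iff by blast
    then show ?thesis
      by (rule burning_number_le)
  qed
qed

lemma burning_number_eq:
  assumes "split_graph G" and "isolated_verts G \<noteq> verts G" and "card (isolated_verts G) \<ge> 2"
  shows "burning_number G = card (isolated_verts G) + 1"
  unfolding burning_number_def
proof (rule Least_equality)
  show "\<exists>x. burns_in G x (card (isolated_verts G) + 1)"
    by (rule burns_in_card_isolated[OF assms])
  show "card (isolated_verts G) + 1 \<le> k" if "\<exists>x. burns_in G x k" for k
    using that card_isolated_less assms(2) by (auto simp: Suc_le_eq)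
qed

section \<open>Large components and isolated vertices\<close>

lemma large_component_iff:
  "(\<exists>C \<in> components G. card (verts C) \<ge> 2) \<longleftrightarrow> isolated_verts G \<noteq> verts G"
proof
  assume "\<exists>C \<in> components G. card (verts C) \<ge> 2"
  then obtain C where C: "C \<in> components G" "2 \<le> card (verts C)"
    by blast
  then have S: "verts C \<in> sccs_verts"
    using sccs_verts_conv by blast
  obtain u where u: "u \<in> verts C"
    using C(2) by fastforce
  have "\<not> verts C \<subseteq> {u}"
    using C(2) card_mono[of "{u}" "verts C"] by auto
  then obtain w where w: "w \<in> verts C" "w \<noteq> u"
    by blast
  have "u \<rightarrow>\<^sup>* w"
    using S u w unfolding in_sccs_verts_conv_reachable by blast
  \<comment> \<open>A path between distinct vertices begins with an arc.\<close>
  then obtain z where "u \<rightarrow>\<^bsub>G\<^esub> z"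
    using w(2) by (metis converse_reachable_cases)
  then show "isolated_verts G \<noteq> verts G"
    using adj_not_isolated adj_in_verts by blast
next
  assume "isolated_verts G \<noteq> verts G"
  then obtain u w where uw: "u \<rightarrow>\<^bsub>G\<^esub> w"
    using isolated_subset_verts not_isolatedE by blast
  then have "u \<in> verts G" "u \<noteq> w"
    using adj_in_verts adj_not_same by auto
  obtain C where C: "C \<in> components G" "verts C = scc_of u"
    using scc_of_in_sccs_verts[OF \<open>u \<in> verts G\<close>] sccs_verts_conv by auto
  \<comment> \<open>Strong connectivity also requires a way back from \<open>w\<close> to
    \<open>u\<close>, which symmetry provides.\<close>
  have "{u, w} \<subseteq> verts C"
    using uw adj_sym \<open>u \<in> verts G\<close> C(2) by (auto simp: scc_of_def)
  moreover have "finite (verts C)"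
    using C(2) sccs_verts_subsets[OF scc_of_in_sccs_verts[OF \<open>u \<in> verts G\<close>]]
    by (simp add: finite_subset)
  ultimately have "card {u, w} \<le> card (verts C)"
    by (intro card_mono)
  then show "\<exists>C \<in> components G. card (verts C) \<ge> 2"
    using C(1) \<open>u \<noteq> w\<close> by (intro bexI[of _ C]) simp_all
qed

end

theorem theorem3p4:
  fixes G :: "('a, 'b) pre_digraph"
  assumes "graph G" and "split_graph G" and "disconnected G"
  shows "((\<nexists>C. C \<in> components G \<and> card (verts C) \<ge> 2) \<longrightarrow>
            burning_number G = card (verts G)) \<and>
         (\<forall>Gc n. Gc \<in> components G \<and> card (verts Gc) \<ge> 2 \<and>
            verts G = verts Gc \<union> isolated_verts G \<and> card (isolated_verts G) = n \<and> n \<ge> 1 \<longrightarrow>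
            (if n \<le> 2 then burning_number G \<le> 3 else burning_number G = n + 1))"
proof -
  interpret graph G by fact
  show ?thesis
  proof (intro conjI impI allI)
    assume "\<nexists>C. C \<in> components G \<and> card (verts C) \<ge> 2"
    then show "burning_number G = card (verts G)"
      using large_component_iff burning_number_all_isolated by blast
  next
    fix Gc n
    assume asm: "Gc \<in> components G \<and> card (verts Gc) \<ge> 2 \<and>
      verts G = verts Gc \<union> isolated_verts G \<and> card (isolated_verts G) = n \<and> n \<ge> 1"
    then have ne: "isolated_verts G \<noteq> verts G"
      using large_component_iff by blast
    show "if n \<le> 2 then burning_number G \<le> 3 else burning_number G = n + 1"
    \<comment> \<open>The split is at 1 and not at 2: for \<open>n = 2\<close> the exact value
      \<open>n + 1\<close> is already the bound 3.\<close>
    proof (cases "n = 1")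
      case True
      then show ?thesis using burning_number_le_3[OF assms(2) ne] asm by simp
    next
      case False
      then show ?thesis using burning_number_eq[OF assms(2) ne] asm by auto
    qed
  qed
qed

end
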